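(* Let $q$ be a power of a prime $p$, let $n\geq 2$ be an integer, and write $n=mp^e$ with $e\geq 0$ and $p\nmid m$. Then \[ q^{n-m}\prod_{d\mid m}\bigl(q^{\tau(d)}-1\bigr)^{\phi(d)/\tau(d)} \;\leq\;\frac{q-1}{q}\sum_{d\mid m}\mu(d)\,q^{n/d}, \] where the product and sum run over the positive divisors $d$ of $m$, $\tau(d)$ is the multiplicative order of $q$ modulo $d$ (with $\tau(1)=1$), $\phi$ is Euler's totient function, and $\mu$ is the Möbius function. Moreover, equality holds if and only if either $n=p^e$ (i.e. $m=1$), or $n$ is a prime different from $p$ and $q$ is a primitive root modulo $n$.
   Context: The left-hand side equals the number of normal elements of $\mathbb{F}_{q^n}$ over $\mathbb{F}_q$ (elements $\alpha$ such that $\alpha,\alpha^q,\dots,\alpha^{q^{n-1}}$ are linearly independent over $\mathbb{F}_q$), and the right-hand side equals $n$ times the number of monic irreducible polynomials of degree $n$ over $\mathbb{F}_q$ whose coefficient of $x^{n-1}$ is nonzero; the statement itself is the purely numerical inequality above. *)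

theory Defs
  imports
    Complex_Main
    "HOL-Number_Theory.Number_Theory"
    "HOL-Computational_Algebra.Squarefree"
begin

(* The library convention for squarefree gives moebius 0 = 0. *)
definition moebius :: "nat \<Rightarrow> int" where
  "moebius n = (if squarefree n then (-1) ^ card (prime_factors n) else 0)"

end

(* Divide both sides by (1 - 1/q) q^n.  The left-hand side becomes the product over the divisors
   d > 1 of m of the factors (1 - q^(-tau d))^(phi d / tau d), all of which lie in [0,1], because
   the totients of the divisors of m add up to m.  For m = 1 both sides are 1.  Otherwise let l be the least divisor of m exceeding 1.
   Keeping only the factor of l, and using tau l \<le> l - 1, the product is at most 1 - q^(-(l-1)).
   On the right the exponents n/d with d > 1 are distinct and at most n/l, so that the normalised
   sum exceeds 1 - 2 q^(-(n - n/l)).  If n > l then n - n/l = (n/l)(l-1) \<ge> 2(l-1) \<ge> l, which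
   gives strict inequality.  If n = l, then n is prime and both sides are explicit. *)

theory Submission
  imports Defs
begin

text \<open>Adding the next power keeps the bound, because \<open>2 * x ^ K\<close> is at most
  \<open>x ^ Suc K\<close>.\<close>

lemma sum_powers_less:
  fixes x :: real
  assumes "x \<ge> 2"
  shows "(\<Sum>k\<le>K. x ^ k) < 2 * x ^ K"
proof (induction K)
  case (Suc K)
  have "2 * x ^ K \<le> x * x ^ K" using assms by (intro mult_right_mono) auto
  with Suc show ?case by simp
qed auto

lemma sum_moebius_powers_gt:
  fixes x :: real
  assumes x: "x \<ge> 2" and n: "n > 0" and m: "m dvd n" and l: "l > 0"
    and least: "\<And>d. d dvd m \<Longrightarrow> d > 1 \<Longrightarrow> l \<le> d"
  shows "(\<Sum>d | d dvd m. real_of_int (moebius d) * x ^ (n div d)) > x ^ n - 2 * x ^ (n div l)"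
proof -
  have "m > 0" using m n by (meson dvd_pos_nat)
  let ?D = "{d. d dvd m \<and> d > 1}"
  have D: "{d. d dvd m} = insert 1 ?D"
    using \<open>m > 0\<close> by (auto simp: Suc_lessI dvd_pos_nat intro!: Nat.gr0I)
  have fin: "finite ?D" using \<open>m > 0\<close> by simp
  have inj: "inj_on (\<lambda>d. n div d) ?D"
  proof (rule inj_onI)
    fix a b assume "a \<in> ?D" "b \<in> ?D" and eq: "n div a = n div b"
    then have "a dvd n" "b dvd n" using m dvd_trans by auto
    then have "a * (n div a) = n" "b * (n div a) = n"
      using dvd_mult_div_cancel[of a n] dvd_mult_div_cancel[of b n] eq by simp_all
    then show "a = b" using n by (metis mult_cancel2 mult_0_right neq0_conv)
  qed
  \<comment> \<open>Indexed by its exponents, which are distinct, the sum is part of a geometric sum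
    ending at \<open>n div l\<close>.\<close>
  have "(\<Sum>d\<in>?D. x ^ (n div d)) = (\<Sum>k\<in>(\<lambda>d. n div d) ` ?D. x ^ k)"
    using inj by (simp add: sum.reindex)
  also have "\<dots> \<le> (\<Sum>k\<le>n div l. x ^ k)"
    using x l least by (intro sum_mono2) (auto intro: div_le_mono2)
  also have "\<dots> < 2 * x ^ (n div l)" using x by (rule sum_powers_less)
  finally have upper: "(\<Sum>d\<in>?D. x ^ (n div d)) < 2 * x ^ (n div l)" .
  \<comment> \<open>Worst case: every divisor other than 1 enters with coefficient -1.\<close>
  have "- (x ^ (n div d)) \<le> real_of_int (moebius d) * x ^ (n div d)" for d
  proof -
    have "real_of_int (moebius d) \<ge> -1"
      by (auto simp: moebius_def minus_one_power_iff)
    then have "-1 * x ^ (n div d) \<le> real_of_int (moebius d) * x ^ (n div d)"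
      using x by (intro mult_right_mono) auto
    then show ?thesis by simp
  qed
  then have "(\<Sum>d\<in>?D. - (x ^ (n div d))) \<le> (\<Sum>d\<in>?D. real_of_int (moebius d) * x ^ (n div d))"
    by (intro sum_mono)
  moreover have "moebius 1 = 1" by (simp add: moebius_def)
  ultimately show ?thesis
    using upper fin by (simp add: D sum_negf)
qed

text \<open>For \<open>d\<close> coprime to a prime power \<open>q\<close>, this is the proportion
  of units in F_q[x]/(Phi_d): the cyclotomic polynomial Phi_d has
  \<open>totient d div ord d q\<close> irreducible factors, each of degree
  \<open>ord d q\<close>.\<close>

definition order_factor :: "nat \<Rightarrow> nat \<Rightarrow> real" where
  "order_factor q d = (1 - 1 / real q ^ ord d q) ^ (totient d div ord d q)"

lemma order_factor_nonneg: "q > 0 \<Longrightarrow> order_factor q d \<ge> 0"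
  by (simp add: order_factor_def)

lemma order_factor_le_1: "q > 0 \<Longrightarrow> order_factor q d \<le> 1"
  by (auto simp: order_factor_def intro!: power_le_one)

text \<open>By Euler's theorem the order divides the totient, so pulling \<open>q ^ ord d q\<close>
  out of every factor yields exactly \<open>q ^ totient d\<close>.\<close>

lemma power_ord_minus_1:
  assumes "q > 0" "coprime d q"
  shows "(real q ^ ord d q - 1) ^ (totient d div ord d q) = real q ^ totient d * order_factor q d"
proof -
  have "ord d q * (totient d div ord d q) = totient d"
    using assms order_divides_totient by simp
  then have "real q ^ totient d = (real q ^ ord d q) ^ (totient d div ord d q)"
    by (metis power_mult)
  then show ?thesis
    using assms by (simp add: order_factor_def flip: power_mult_distrib)
      (simp add: right_diff_distrib)
qed

text \<open>The powers pulled out combine to \<open>q ^ m\<close>, since the totients of the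
  divisors of \<open>m\<close> sum to \<open>m\<close>.\<close>

lemma prod_power_ord_minus_1:
  assumes "q > 0" "m > 0" "coprime m q" "m \<le> n"
  shows "real q ^ (n - m) * (\<Prod>d | d dvd m. (real q ^ ord d q - 1) ^ (totient d div ord d q))
       = real q ^ n * (\<Prod>d | d dvd m. order_factor q d)"
proof -
  have "(\<Prod>d | d dvd m. (real q ^ ord d q - 1) ^ (totient d div ord d q))
      = (\<Prod>d | d dvd m. real q ^ totient d * order_factor q d)"
    using assms by (intro prod.cong power_ord_minus_1) (auto intro: coprime_divisors)
  also have "\<dots> = real q ^ m * (\<Prod>d | d dvd m. order_factor q d)"
    by (simp add: prod.distrib totient_divisor_sum flip: power_sum)
  finally show ?thesis using assms by (simp flip: power_add)
qed

lemma order_factor_1: "order_factor q 1 = 1 - 1 / real q"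
  by (simp add: order_factor_def)

text \<open>The discarded factors lie in [0,1]. The factor of 1 is kept because it matches (q-1)/q
  on the other side of the theorem.\<close>

lemma prod_order_factor_le:
  assumes "q > 0" "m > 0" "l dvd m" "l > 1"
  shows "(\<Prod>d | d dvd m. order_factor q d) \<le> (1 - 1 / real q) * order_factor q l"
proof -
  let ?D = "{d. d dvd m} - {1, l}"
  have D: "{d. d dvd m} = {1, l} \<union> ?D" using assms by auto
  have "(\<Prod>d | d dvd m. order_factor q d) = (\<Prod>d\<in>{1, l}. order_factor q d) * (\<Prod>d\<in>?D. order_factor q d)"
    using assms by (subst D, subst prod.union_disjoint) auto
  also have "\<dots> \<le> (\<Prod>d\<in>{1, l}. order_factor q d) * 1"
    using assms
    by (intro mult_left_mono prod_le_1 prod_nonneg)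
      (auto simp: order_factor_nonneg order_factor_le_1)
  also have "\<dots> = (1 - 1 / real q) * order_factor q l"
    using assms order_factor_1[of q] by simp
  finally show ?thesis .
qed

text \<open>The exponent is at least 1 and the base lies in [0,1], so the power is at most its base;
  the order is at most \<open>totient l\<close>, hence at most \<open>l - 1\<close>.\<close>

lemma order_factor_le:
  assumes "q \<ge> 2" "l > 1" "coprime l q"
  shows "order_factor q l \<le> 1 - 1 / real q ^ (l - 1)"
proof -
  have pos: "ord l q > 0" "totient l > 0" using assms by (simp_all add: coprime_commute)
  have dvd: "ord l q dvd totient l" using assms order_divides_totient by simp
  then have "totient l div ord l q > 0" "ord l q \<le> totient l"
    using pos by (auto simp: div_greater_zero_iff dvd_imp_le)
  moreover have "totient l < l" using assms by (intro totient_less) auto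
  ultimately have "ord l q \<le> l - 1" by simp
  then have "real q ^ ord l q \<le> real q ^ (l - 1)" using assms by (intro power_increasing) auto
  then have "1 / real q ^ (l - 1) \<le> 1 / real q ^ ord l q"
    using assms by (intro divide_left_mono) auto
  moreover have "order_factor q l \<le> (1 - 1 / real q ^ ord l q) ^ 1"
    unfolding order_factor_def using assms \<open>totient l div ord l q > 0\<close>
    by (intro power_decreasing) auto
  ultimately show ?thesis by simp
qed

text \<open>For \<open>k > 1\<close> the chain (1-x)^k \<le> 1-x < 1-x^k is strict. This is the
  source of the equality condition for prime \<open>n\<close>.\<close>

lemma one_minus_power_le:
  fixes x :: real
  assumes "0 < x" "x < 1" "k > 0"
  shows "(1 - x) ^ k \<le> 1 - x ^ k \<and> ((1 - x) ^ k = 1 - x ^ k \<longleftrightarrow> k = 1)"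
proof (cases "k = 1")
  case False
  with assms have "x ^ k < x ^ 1" by (intro power_strict_decreasing) auto
  moreover have "(1 - x) ^ k \<le> (1 - x) ^ 1" using assms by (intro power_decreasing) auto
  ultimately show ?thesis using False by auto
qed auto

text \<open>Apply the previous lemma to x = q^(-ord) and k = (n-1)/ord, so that x^k = q^(-(n-1)); k
  = 1 says that the order is maximal, i.e. \<open>q\<close> is a primitive root.\<close>

lemma order_factor_prime:
  assumes "q \<ge> 2" "prime n" "coprime n q"
  shows "order_factor q n \<le> 1 - 1 / real q ^ (n - 1)"
    and "order_factor q n = 1 - 1 / real q ^ (n - 1) \<longleftrightarrow> residue_primroot n q"
proof -
  let ?k = "totient n div ord n q"
  have t: "totient n = n - 1" "totient n > 0" using assms prime_gt_1_nat[of n]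
    by (simp_all add: totient_prime)
  have o: "ord n q > 0" using assms by (simp add: coprime_commute)
  have mult: "ord n q * ?k = n - 1"
    using assms order_divides_totient t by (metis dvd_mult_div_cancel)
  then have k: "?k > 0" using t by (intro Nat.gr0I) auto
  have "(1 / real q ^ ord n q) ^ ?k = 1 / real q ^ (n - 1)"
    using mult by (metis power_mult power_one_over)
  moreover have "?k = 1 \<longleftrightarrow> ord n q = totient n"
    using mult t o by (auto simp: t)
  moreover have "residue_primroot n q \<longleftrightarrow> ord n q = totient n"
    using assms prime_gt_0_nat by (auto simp: residue_primroot_def)
  moreover have "1 / real q ^ ord n q < 1" "1 / real q ^ ord n q > 0"
    using assms o by auto
  ultimately show "order_factor q n \<le> 1 - 1 / real q ^ (n - 1)"
    and "order_factor q n = 1 - 1 / real q ^ (n - 1) \<longleftrightarrow> residue_primroot n q"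
    using one_minus_power_le[of "1 / real q ^ ord n q" ?k] k unfolding order_factor_def by auto
qed

theorem theorem1p4:
  fixes p q r n m e :: nat
  assumes "prime p" and "r > 0" and "q = p ^ r"
    and "n \<ge> 2" and "n = m * p ^ e" and "\<not> p dvd m"
  shows "real q ^ (n - m) *
           (\<Prod>d | d dvd m. (real q ^ ord d q - 1) ^ (totient d div ord d q))
         \<le> (real q - 1) / real q *
           (\<Sum>d | d dvd m. real_of_int (moebius d) * real q ^ (n div d))
       \<and> (real q ^ (n - m) *
           (\<Prod>d | d dvd m. (real q ^ ord d q - 1) ^ (totient d div ord d q))
         = (real q - 1) / real q *
           (\<Sum>d | d dvd m. real_of_int (moebius d) * real q ^ (n div d))
         \<longleftrightarrow> n = p ^ e \<or> (prime n \<and> n \<noteq> p \<and> residue_primroot n q))"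
proof -
  have p2: "p \<ge> 2" using assms(1) by (rule prime_ge_2_nat)
  then have "p ^ 1 \<le> p ^ r" using assms(2) by (intro power_increasing) auto
  then have q2: "q \<ge> 2" using p2 assms(3) by simp
  have m0: "m > 0" using assms(4,5) by (intro Nat.gr0I) auto
  have "coprime p m" using assms(1,6) by (rule prime_imp_coprime)
  then have cop: "coprime m q" using assms(3) by (simp add: coprime_commute)
  have mn: "m dvd n" using assms(5) by simp
  then have "m \<le> n" using assms(4) by (intro dvd_imp_le) auto
  define L where "L = (\<Prod>d | d dvd m. order_factor q d)"
  define S where "S = (\<Sum>d | d dvd m. real_of_int (moebius d) * real q ^ (n div d))"
  have lhs: "real q ^ (n - m) *
      (\<Prod>d | d dvd m. (real q ^ ord d q - 1) ^ (totient d div ord d q)) = real q ^ n * L"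
    unfolding L_def using q2 m0 cop \<open>m \<le> n\<close> by (intro prod_power_ord_minus_1) auto
  have c: "(real q - 1) / real q = 1 - 1 / real q" "1 - 1 / real q > 0"
    using q2 by (simp_all add: field_simps)
  have mu1: "moebius 1 = 1" by (simp add: moebius_def)
  consider "m = 1" | "m > 1" using m0 by linarith
  then have "real q ^ n * L \<le> (1 - 1 / real q) * S \<and>
    (real q ^ n * L = (1 - 1 / real q) * S
      \<longleftrightarrow> n = p ^ e \<or> (prime n \<and> n \<noteq> p \<and> residue_primroot n q))"
  proof cases
    case 1
    then have "L = 1 - 1 / real q" "S = real q ^ n"
      using order_factor_1[of q] mu1 by (simp_all add: L_def S_def)
    then show ?thesis using 1 assms(5) by simp
  next
    case 2
    define l where "l = (LEAST d. d dvd m \<and> d > 1)"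
    have l: "l dvd m" "l > 1"
      using LeastI[of "\<lambda>d. d dvd m \<and> d > 1" m] 2 by (auto simp: l_def)
    have least: "l \<le> d" if "d dvd m" "d > 1" for d
      using that unfolding l_def by (intro Least_le) auto
    have "p ^ e > 0" using p2 by simp
    then have not1: "n \<noteq> p ^ e" using 2 assms(5) by auto
    have ln: "l dvd n" using l mn dvd_trans by blast
    show ?thesis
    proof (cases "l = n")
      case True
      \<comment> \<open>Minimality of \<open>l = n\<close> leaves only the divisors 1 and
        \<open>n\<close>, so both sides become explicit.\<close>
      then have eq: "m = n" using l mn by (auto intro: dvd_antisym)
      have "prime n" unfolding prime_nat_iff
      proof (intro conjI allI impI)
        show "1 < n" using assms(4) by simp
        fix d assume d: "d dvd n"
        then have "d > 0" "d \<le> n"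
          using assms(4) dvd_pos_nat[of n d] by (auto intro: dvd_imp_le)
        then show "d = 1 \<or> d = n" using least[of d] d eq True by force
      qed
      then have D: "{d. d dvd m} = {1, n}" using eq by (auto simp: prime_nat_iff)
      have "L = (1 - 1 / real q) * order_factor q n"
        using assms(4) order_factor_1[of q] by (simp add: L_def D)
      \<comment> \<open>The two terms give q^n - q, and q = q^n / q^(n-1).\<close>
      moreover have "S = real q ^ n * (1 - 1 / real q ^ (n - 1))"
      proof -
        have "moebius n = -1"
          using \<open>prime n\<close> by (simp add: moebius_def squarefree_prime prime_factorization_prime)
        moreover have "real q ^ n = real q * real q ^ (n - 1)"
          using assms(4) by (simp flip: power_Suc)
        ultimately show ?thesis
          using assms(4) q2 mu1 by (simp add: S_def D right_diff_distrib)
      qed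
      moreover have "n \<noteq> p" using assms(6) eq by auto
      moreover note order_factor_prime[OF q2 \<open>prime n\<close>] not1 \<open>prime n\<close> cop eq c(2)
      ultimately show ?thesis
        using q2 by (auto simp: mult.left_commute)
    next
      case False
      define k where "k = n div l"
      have nk: "n = l * k" using ln by (simp add: k_def)
      then have "k \<noteq> 1" using False by auto
      moreover have "k \<noteq> 0" using nk assms(4) by (metis mult_0_right not_numeral_le_zero)
      ultimately have k2: "k \<ge> 2" by linarith
      have "\<not> prime n" using ln l False by (auto simp: prime_nat_iff)
      have "coprime l q" using cop l by (auto intro: coprime_divisors)
      \<comment> \<open>Here k(l-1) = n-k, while 2(l-1) \<ge> l because \<open>l\<close> is at least
        2; together k + l \<le> n.\<close>
      have "2 * (l - 1) \<le> k * (l - 1)" using k2 by (rule mult_right_mono) simp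
      then have "k + l \<le> n" using nk l by (simp add: algebra_simps diff_mult_distrib2)
      then have "1 + k \<le> n - (l - 1)" using l by linarith
      then have "real q ^ (1 + k) \<le> real q ^ (n - (l - 1))"
        using q2 by (intro power_increasing) auto
      \<comment> \<open>The spare 1 in the exponent \<open>1 + k\<close> absorbs the constant 2 of
        the geometric bound.\<close>
      moreover have "2 * real q ^ k \<le> real q * real q ^ k"
        using q2 by (intro mult_right_mono) auto
      ultimately have *: "2 * real q ^ k \<le> real q ^ (n - (l - 1))" by simp
      have "l - 1 \<le> n" using \<open>k + l \<le> n\<close> by simp
      have "L \<le> (1 - 1 / real q) * order_factor q l"
        unfolding L_def using q2 m0 l by (intro prod_order_factor_le) auto
      also have "\<dots> \<le> (1 - 1 / real q) * (1 - 1 / real q ^ (l - 1))"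
        using c q2 l \<open>coprime l q\<close> by (intro mult_left_mono order_factor_le) auto
      finally have "real q ^ n * L \<le> real q ^ n * ((1 - 1 / real q) * (1 - 1 / real q ^ (l - 1)))"
        by (rule mult_left_mono) simp
      also have "\<dots> = (1 - 1 / real q) * (real q ^ n - real q ^ (n - (l - 1)))"
        using q2 \<open>l - 1 \<le> n\<close> by (simp add: power_diff algebra_simps)
      also have "\<dots> \<le> (1 - 1 / real q) * (real q ^ n - 2 * real q ^ k)"
        using c * by (intro mult_left_mono) auto
      \<comment> \<open>Strictness here rules out equality, in accordance with \<open>n\<close>
        being neither prime nor equal to \<open>p ^ e\<close>.\<close>
      also have "\<dots> < (1 - 1 / real q) * S"
      proof (rule mult_strict_left_mono)
        show "real q ^ n - 2 * real q ^ k < S"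
          unfolding S_def k_def using q2 assms(4) mn l least by (intro sum_moebius_powers_gt) auto
      qed (use c in simp)
      finally show ?thesis using not1 \<open>\<not> prime n\<close> by auto
    qed
  qed
  then show ?thesis unfolding lhs c(1) S_def .
qed

end
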